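(* Let $r$ be a weight and let $\underline h=(h^0,h^1,\ldots,h^r)$ be Hodge numbers with $h^p=h^{r-p}$ and $h^0>0$. Then the weak polarized relations graph $\mathcal{R}_0^\circ(\underline h)$ is (i) maximal if and only if $\underline h\geq h^0.\underline c^r$; and (ii) saturated if and only if $\underline h\geq h^0.\underline b^r$.
   Context: Admissible Hodge diamonds. For nonnegative integers $\underline h=(h^0,\ldots,h^r)$ with $h^p=h^{r-p}$, an admissible Hodge diamond of type $\underline h$ is a collection of nonnegative integers $\Diamond=\{\Diamond^{p,q}\}_{0\leq p,q\leq r}$ (with $\Diamond^{p,q}:=0$ for other $p,q$) such that $\sum_q\Diamond^{p,q}=h^p$ for all $p$; $\Diamond^{q,p}=\Diamond^{p,q}=\Diamond^{r-q,r-p}=\Diamond^{r-p,r-q}$; and $\Diamond^{p,q}\leq\Diamond^{p+1,q+1}$ for $p+q<r$. Polarized relation. For an admissible $\Diamond_1$ of type $\underline h$ put $P_w^{p,w-p}:=\Diamond_1^{p,w-p}-\Diamond_1^{p-1,w-p-1}$ for $0\leq w\leq r$. Then $\Diamond_1\preceq\Diamond_0$ means that there exist admissible (weight-$w$) Hodge diamonds $\Diamond_{P_w}$ of type $(P_w^{0,w},P_w^{1,w-1},\ldots,P_w^{w,0})$, $0\leq w\leq r$, with $\Diamond_0=\sum_{w=0}^r\sum_{a=0}^{r-w}\Diamond_{P_w}(-a)$, where $(\Diamond_{P_w}(-a))^{p,q}:=\Diamond_{P_w}^{p-a,q-a}$. The graph $\mathcal{R}_0^\circ(\underline h)$. Its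 vertices are the $\mathrm{Gr}_F^0$-parts $\widetilde{\Diamond}$ of admissible Hodge diamonds $\Diamond$ of type $\underline h$, i.e. the functions $\underline a\colon\{0,\ldots,r\}\to\mathbb{Z}_{\geq0}$, $\underline a(q)=\Diamond^{0,q}$, arising from some admissible $\Diamond$. There is an arrow $\widetilde{\Diamond}_1\preceq\widetilde{\Diamond}_0$ iff there exist admissible diamonds $\Diamond_1,\Diamond_0$ of type $\underline h$ with these $\mathrm{Gr}_F^0$-parts and $\Diamond_1\preceq\Diamond_0$. Let $\mathcal{A}^r(m)$ be the set of functions $\underline a\colon\{0,1,\ldots,r\}\to\mathbb{Z}_{\geq 0}$ with $\sum_{k=0}^r\underline a(k)=m$, and write $\underline A(\ell):=\sum_{k=0}^\ell\underline a(k)$. It is partially ordered by $\underline a_1\sqsubseteq\underline a_0\iff\underline A_1(\ell)\leq\underline A_0(\ell)$ for all $\ell$. The vertex set of $\mathcal{R}_0^\circ(\underline h)$ is a subset of $\mathcal{A}^r(h^0)$, and its arrows are a subset of those given by $\sqsubseteq$. $\mathcal{R}_0^\circ(\underline h)$ is called maximal if its vertex set equals $\mathcal{A}^r(h^0)$, and saturated if it is maximal and its set of arrows equals $\sqsubseteq$. The functions $\underline b^r,\underline c^r$ on $\{0,1,\ldots,r\}$ are: $\underline b^r(i)=\underline b^r(r-i)=2i+1$ for $i<\tfrac r2$, and $\underline b^r(\tfrac r2)=r$ if $r$ is even; $\underline c^r(0)=\underline c^r(r)=1$ and $\underline c^r(i)=2$ for $0<i<r$. For functions on $\{0,\ldots,r\}$,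 $\underline f\geq\underline g$ means $\underline f(i)\geq\underline g(i)$ for all $i$, and $e.\underline f$ denotes scalar multiplication; $\underline h$ is viewed as the function $i\mapsto h^i$. *)

theory Defs
  imports Main
begin

text \<open>
  Bidegrees are integers, so that the shifts \<open>p - a\<close> are not truncated; the entries outside
  the square \<open>0 \<le> p, q \<le> r\<close> are zero.  A function on \<open>{0..r}\<close> is represented by a function on
  \<^typ>\<open>nat\<close>: for Hodge numbers the values beyond \<open>r\<close> are never used, whereas the elements of
  \<open>funs r m\<close> below vanish beyond \<open>r\<close>, so that equality means equality on \<open>{0..r}\<close>.
\<close>

type_synonym diamond = "int \<Rightarrow> int \<Rightarrow> nat"

definition admissible :: "nat \<Rightarrow> (nat \<Rightarrow> nat) \<Rightarrow> diamond \<Rightarrow> bool" where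
  "admissible r h D \<longleftrightarrow>
     (\<forall>p q. \<not> (0 \<le> p \<and> p \<le> int r \<and> 0 \<le> q \<and> q \<le> int r) \<longrightarrow> D p q = 0) \<and>
     (\<forall>p\<le>r. (\<Sum>q\<in>{0..int r}. D (int p) q) = h p) \<and>
     (\<forall>p q. D q p = D p q \<and> D p q = D (int r - q) (int r - p)
                          \<and> D p q = D (int r - p) (int r - q)) \<and>
     (\<forall>p q. p + q < int r \<longrightarrow> D p q \<le> D (p + 1) (q + 1))"

text \<open>
  For \<open>w \<le> r\<close> and an admissible diamond of weight \<open>r\<close> the subtraction does not truncate,
  see the lemma below.
\<close>

definition primitive_hodge :: "diamond \<Rightarrow> nat \<Rightarrow> nat \<Rightarrow> nat" where
  "primitive_hodge D w p =
     D (int p) (int w - int p) - D (int p - 1) (int w - int p - 1)"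

lemma primitive_hodge_no_truncation:
  assumes "admissible r h D" "w \<le> r"
  shows "D (int p - 1) (int w - int p - 1) \<le> D (int p) (int w - int p)"
proof -
  have step: "\<forall>x y. x + y < int r \<longrightarrow> D x y \<le> D (x + 1) (y + 1)"
    using assms(1) unfolding admissible_def by blast
  have "(int p - 1) + (int w - int p - 1) < int r"
    using assms(2) by simp
  then have "D (int p - 1) (int w - int p - 1)
      \<le> D (int p - 1 + 1) (int w - int p - 1 + 1)"
    using step by blast
  then show ?thesis by simp
qed

definition twist :: "diamond \<Rightarrow> nat \<Rightarrow> diamond" where
  "twist D a = (\<lambda>p q. D (p - int a) (q - int a))"

definition polarized_rel :: "nat \<Rightarrow> diamond \<Rightarrow> diamond \<Rightarrow> bool" where
  "polarized_rel r D1 D0 \<longleftrightarrow>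
     (\<exists>DP. (\<forall>w\<le>r. admissible w (primitive_hodge D1 w) (DP w)) \<and>
           (\<forall>p q. D0 p q = (\<Sum>w\<in>{0..r}. \<Sum>a\<in>{0..r - w}. twist (DP w) a p q)))"

definition gr0_part :: "diamond \<Rightarrow> nat \<Rightarrow> nat" where
  "gr0_part D = (\<lambda>q. D 0 (int q))"

definition R0_vertices :: "nat \<Rightarrow> (nat \<Rightarrow> nat) \<Rightarrow> (nat \<Rightarrow> nat) set" where
  "R0_vertices r h = {gr0_part D | D. admissible r h D}"

definition R0_arrows :: "nat \<Rightarrow> (nat \<Rightarrow> nat) \<Rightarrow> ((nat \<Rightarrow> nat) \<times> (nat \<Rightarrow> nat)) set" where
  "R0_arrows r h =
     {(gr0_part D1, gr0_part D0) | D1 D0.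
        admissible r h D1 \<and> admissible r h D0 \<and> polarized_rel r D1 D0}"

definition funs :: "nat \<Rightarrow> nat \<Rightarrow> (nat \<Rightarrow> nat) set" where
  "funs r m = {a. (\<forall>k>r. a k = 0) \<and> (\<Sum>k\<in>{0..r}. a k) = m}"

definition dom_le :: "nat \<Rightarrow> (nat \<Rightarrow> nat) \<Rightarrow> (nat \<Rightarrow> nat) \<Rightarrow> bool" where
  "dom_le r a1 a0 \<longleftrightarrow> (\<forall>l\<le>r. (\<Sum>k\<in>{0..l}. a1 k) \<le> (\<Sum>k\<in>{0..l}. a0 k))"

definition R0_maximal :: "nat \<Rightarrow> (nat \<Rightarrow> nat) \<Rightarrow> bool" where
  "R0_maximal r h \<longleftrightarrow> R0_vertices r h = funs r (h 0)"

definition R0_saturated :: "nat \<Rightarrow> (nat \<Rightarrow> nat) \<Rightarrow> bool" where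
  "R0_saturated r h \<longleftrightarrow> R0_maximal r h \<and>
     R0_arrows r h = {(a1, a0). a1 \<in> funs r (h 0) \<and> a0 \<in> funs r (h 0) \<and> dom_le r a1 a0}"

definition b_fun :: "nat \<Rightarrow> nat \<Rightarrow> nat" where
  "b_fun r i = (if 2 * i < r then 2 * i + 1 else if 2 * i = r then r else 2 * (r - i) + 1)"

definition c_fun :: "nat \<Rightarrow> nat \<Rightarrow> nat" where
  "c_fun r i = (if i = 0 \<or> i = r then 1 else 2)"

end

theory Submission
  imports Defs
begin

text \<open>
  On the square \<open>0 \<le> p, q \<le> r\<close> the diagonal through \<open>(0, k)\<close> is unimodal and symmetric about
  \<open>p + q = r\<close>.  So a diamond with \<open>Gr\<^sub>F\<^sup>0\<close>-part \<open>a\<close> dominates \<open>(p, q) \<mapsto> a |p - q|\<close>, and this function,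
  completed on the antidiagonal \<open>p + q = r\<close>, is itself admissible as soon as its row sums do
  not exceed \<open>h\<close>.  The extremal case is \<open>a = h 0 \<cdot> e\<^sub>1\<close>, whose row sums are \<open>h 0 \<cdot> c\<close>.

  For arrows, a relation \<open>a1 \<sqsubseteq> a0\<close> amounts to a transport plan moving mass \<open>t w q\<close> from \<open>w\<close>
  to \<open>q \<le> w\<close>; the row \<open>t w\<close> has to be realised by a diamond of weight \<open>w\<close> whose type is the
  primitive part \<open>P\<^sub>w\<close>.  By the first part this is possible for every \<open>t\<close> once
  \<open>P\<^sub>w \<ge> a1 w \<cdot> c\<^sup>w\<close>, and it forces this bound when \<open>a1 = h 0 \<cdot> e\<^sub>w\<close> and \<open>a0 = h 0 \<cdot> e\<^sub>1\<close>.  The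
  Lefschetz strings on these primitive parts contribute at most \<open>h 0 \<cdot> b i\<close> to row \<open>i\<close>, with
  equality for \<open>w = r - i\<close>, \<open>i \<le> r/2\<close> (if \<open>r > 0\<close>; \<open>b = 0\<close> for \<open>r = 0\<close>).
\<close>

section \<open>Admissible diamonds\<close>

lemma admissible_zero:
  "admissible r h D \<Longrightarrow> \<not> (0 \<le> p \<and> p \<le> int r \<and> 0 \<le> q \<and> q \<le> int r) \<Longrightarrow> D p q = 0"
  unfolding admissible_def by blast

lemma admissible_row_sum:
  "admissible r h D \<Longrightarrow> p \<le> r \<Longrightarrow> (\<Sum>q\<in>{0..int r}. D (int p) q) = h p"
  unfolding admissible_def by blast

lemma admissible_transpose: "admissible r h D \<Longrightarrow> D q p = D p q"
  unfolding admissible_def by blast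

lemma admissible_reflect: "admissible r h D \<Longrightarrow> D (int r - q) (int r - p) = D p q"
  unfolding admissible_def by metis

lemma admissible_rotate: "admissible r h D \<Longrightarrow> D (int r - p) (int r - q) = D p q"
  unfolding admissible_def by metis

lemma admissible_step: "admissible r h D \<Longrightarrow> p + q < int r \<Longrightarrow> D p q \<le> D (p + 1) (q + 1)"
  unfolding admissible_def by blast

lemma admissibleI:
  assumes "\<And>p q. \<not> (0 \<le> p \<and> p \<le> int r \<and> 0 \<le> q \<and> q \<le> int r) \<Longrightarrow> D p q = 0"
    and "\<And>p. p \<le> r \<Longrightarrow> (\<Sum>q\<in>{0..int r}. D (int p) q) = h p"
    and "\<And>p q. D q p = D p q"
    and "\<And>p q. D (int r - q) (int r - p) = D p q"
    and "\<And>p q. p + q < int r \<Longrightarrow> D p q \<le> D (p + 1) (q + 1)"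
  shows "admissible r h D"
  unfolding admissible_def using assms by metis

lemma admissible_cong:
  "(\<And>p. p \<le> r \<Longrightarrow> h p = h' p) \<Longrightarrow> admissible r h D \<longleftrightarrow> admissible r h' D"
  unfolding admissible_def by simp

text \<open>The half-turn \<open>(p, q) |-> (r - p, r - q)\<close> exchanges rows \<open>p\<close>
  and \<open>r - p\<close>. This gives the symmetry of a type that is known only through some
  diamond realising it.\<close>

lemma admissible_hodge_sym:
  assumes D: "admissible r h D" and p: "p \<le> r"
  shows "h (r - p) = h p"
proof -
  have "(\<Sum>q\<in>{0..int r}. D (int (r - p)) q) = (\<Sum>q\<in>{0..int r}. D (int p) q)"
    by (rule sum.reindex_bij_witness[where i = "\<lambda>q. int r - q" and j = "\<lambda>q. int r - q"])
      (use admissible_rotate[OF D, of "int p"] p in \<open>auto simp: of_nat_diff, metis diff_diff_eq2 add_diff_cancel_left'\<close>)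
  then show ?thesis
    using admissible_row_sum[OF D p] admissible_row_sum[OF D, of "r - p"] by (metis diff_le_self)
qed

lemma admissible_step_iterate:
  assumes D: "admissible r h D"
  shows "p + q + 2 * int k \<le> int r \<Longrightarrow> D p q \<le> D (p + int k) (q + int k)"
proof (induction k)
  case (Suc k)
  have "D p q \<le> D (p + int k) (q + int k)"
    using Suc by simp
  also have "\<dots> \<le> D (p + int k + 1) (q + int k + 1)"
    by (rule admissible_step[OF D]) (use Suc.prems in simp)
  finally show ?case by (simp add: algebra_simps)
qed simp

text \<open>The bound on \<open>k\<close> says that the shifted point is no farther from the line
  \<open>p + q = r\<close> than the original one. A target beyond that line is reflected back, which
  keeps it on the same diagonal.\<close>

lemma admissible_unimodal:
  assumes D: "admissible r h D" and k: "p + q + int k \<le> int r"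
  shows "D p q \<le> D (p + int k) (q + int k)"
proof (cases "p + q + 2 * int k \<le> int r")
  case True
  then show ?thesis by (rule admissible_step_iterate[OF D])
next
  case False
  \<comment> \<open>\<open>k'\<close> counts the diagonal steps from \<open>(p, q)\<close> to the
    mirror image of \<open>(p + k, q + k)\<close>.\<close>
  define k' where "k' = nat (int r - p - q - int k)"
  have k': "int k' = int r - p - q - int k"
    using k by (simp add: k'_def)
  have "D p q \<le> D (p + int k') (q + int k')"
    by (rule admissible_step_iterate[OF D]) (use False k' in linarith)
  also have "D (p + int k') (q + int k') = D (int r - (q + int k)) (int r - (p + int k))"
    by (rule arg_cong2[where f = D]) (use k' in linarith)+
  also have "\<dots> = D (p + int k) (q + int k)"
    by (rule admissible_reflect[OF D])
  finally show ?thesis .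
qed

lemma sum_int_atLeastAtMost: "(\<Sum>q\<in>{0..int r}. f q) = (\<Sum>k\<in>{0..r}. f (int k))"
proof -
  have "{0..int r} = int ` {0..r}"
    using image_int_atLeastAtMost[of 0 r] by simp
  then show ?thesis by (simp add: sum.reindex)
qed

lemma admissible_gr0_sum:
  "admissible r h D \<Longrightarrow> (\<Sum>k\<in>{0..r}. D 0 (int k)) = h 0"
  using admissible_row_sum[of r h D 0] by (simp add: sum_int_atLeastAtMost)

lemma gr0_part_in_funs: "admissible r h D \<Longrightarrow> gr0_part D \<in> funs r (h 0)"
  by (auto simp: funs_def gr0_part_def admissible_gr0_sum admissible_zero)

text \<open>The diagonals through \<open>(0, 1)\<close> and \<open>(1, 0)\<close> meet row
  \<open>i\<close> in columns \<open>i + 1\<close> and \<open>i - 1\<close>, both inside the square;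
  unimodality bounds each of these entries below by \<open>D 0 1\<close>.\<close>

lemma admissible_interior_lower_bound:
  assumes D: "admissible r h D" and i: "0 < i" "i < r"
  shows "2 * D 0 1 \<le> h i"
proof -
  have "D 0 1 \<le> D (0 + int i) (1 + int i)"
    by (rule admissible_unimodal[OF D]) (use i in simp)
  moreover have "D 0 1 \<le> D (0 + int (i - 1)) (1 + int (i - 1))"
    by (rule admissible_unimodal[OF D]) (use i in simp)
  moreover have "D (0 + int (i - 1)) (1 + int (i - 1)) = D (int i) (int i - 1)"
    using i admissible_transpose[OF D, of "int i - 1" "int i"] by (simp add: of_nat_diff)
  ultimately have "2 * D 0 1 \<le> (\<Sum>q\<in>{int i - 1, int i + 1}. D (int i) q)"
    by (simp add: add.commute)
  also have "\<dots> \<le> (\<Sum>q\<in>{0..int r}. D (int i) q)"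
    by (rule sum_mono2) (use i in auto)
  also have "\<dots> = h i"
    using admissible_row_sum[OF D] i by simp
  finally show ?thesis .
qed

section \<open>Diamonds with a prescribed first row\<close>

text \<open>Cutting the row at \<open>q = p\<close> leaves the distances \<open>1..p\<close> on one
  side and \<open>0..r - p\<close> on the other; the extra \<open>a 0\<close> completes the first
  range.\<close>

lemma row_sum_abs_diff:
  fixes a :: "nat \<Rightarrow> nat"
  assumes "p \<le> r"
  shows "(\<Sum>q\<in>{0..int r}. a (nat \<bar>int p - q\<bar>)) + a 0 = (\<Sum>k\<in>{0..p}. a k) + (\<Sum>k\<in>{0..r - p}. a k)"
proof -
  have "(\<Sum>q\<in>{0..int r}. a (nat \<bar>int p - q\<bar>))
      = (\<Sum>q\<in>{0..<int p}. a (nat \<bar>int p - q\<bar>)) + (\<Sum>q\<in>{int p..int r}. a (nat \<bar>int p - q\<bar>))"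
    by (subst sum.union_disjoint[symmetric]) (use assms in \<open>auto intro!: sum.cong\<close>)
  moreover have "(\<Sum>q\<in>{0..<int p}. a (nat \<bar>int p - q\<bar>)) = (\<Sum>k\<in>{1..p}. a k)"
    by (rule sum.reindex_bij_witness[where i = "\<lambda>k. int p - int k" and j = "\<lambda>q. nat (int p - q)"]) auto
  moreover have "(\<Sum>q\<in>{int p..int r}. a (nat \<bar>int p - q\<bar>)) = (\<Sum>k\<in>{0..r - p}. a k)"
    by (rule sum.reindex_bij_witness[where i = "\<lambda>k. int p + int k" and j = "\<lambda>q. nat (q - int p)"])
      (use assms in auto)
  moreover have "(\<Sum>k\<in>{0..p}. a k) = a 0 + (\<Sum>k\<in>{1..p}. a k)"
    by (simp add: sum.atLeast_Suc_atMost)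
  ultimately show ?thesis by simp
qed

lemma admissible_prescribed_gr0:
  assumes h_sym: "\<And>p. p \<le> r \<Longrightarrow> h p = h (r - p)"
    and a: "a \<in> funs r (h 0)"
    and h_ge: "\<And>i. i \<le> r \<Longrightarrow> h 0 * c_fun r i \<le> h i"
  shows "\<exists>D. admissible r h D \<and> gr0_part D = a"
proof -
  define s where "s p = (\<Sum>q\<in>{0..int r}. a (nat \<bar>int p - q\<bar>))" for p
  have a_sum: "(\<Sum>k\<in>{0..r}. a k) = h 0" and a_zero: "\<And>k. k > r \<Longrightarrow> a k = 0"
    using a by (auto simp: funs_def)
  have s_eq: "s p + a 0 = (\<Sum>k\<in>{0..p}. a k) + (\<Sum>k\<in>{0..r - p}. a k)" if "p \<le> r" for p
    unfolding s_def using that by (rule row_sum_abs_diff)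
  have s_sym: "s (r - p) = s p" if "p \<le> r" for p
    using s_eq[of p] s_eq[of "r - p"] that by simp
  have s_0: "s 0 = h 0"
    using s_eq[of 0] a_sum by simp
  have partial: "(\<Sum>k\<in>{0..p}. a k) \<le> h 0" if "p \<le> r" for p
    using that by (subst a_sum[symmetric], intro sum_mono2) auto
  have s_le: "s p \<le> h p" if "p \<le> r" for p
  proof (cases "p = 0 \<or> p = r")
    case True
    then show ?thesis using s_0 s_sym[of 0] h_sym[of 0] by auto
  next
    case False
    have "s p \<le> h 0 * 2"
      using s_eq[OF that] partial[OF that] partial[of "r - p"] by linarith
    then show ?thesis
      using h_ge[OF that] False by (simp add: c_fun_def)
  qed
  \<comment> \<open>The first term is constant along diagonals. The second supplies what row
    \<open>p\<close> lacks; for \<open>p + q < r\<close> it can occur only on the larger side of the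
    step inequality.\<close>
  define D :: diamond where "D p q = (if 0 \<le> p \<and> p \<le> int r \<and> 0 \<le> q \<and> q \<le> int r
      then a (nat \<bar>p - q\<bar>) + (if p + q = int r then h (nat p) - s (nat p) else 0) else 0)" for p q
  have rest_sym: "h (nat (int r - p)) - s (nat (int r - p)) = h (nat p) - s (nat p)"
    if "0 \<le> p" "p \<le> int r" for p
  proof -
    have "nat (int r - p) = r - nat p" using that by linarith
    then show ?thesis using s_sym[of "nat p"] h_sym[of "nat p"] that by simp
  qed
  have "admissible r h D"
  proof (rule admissibleI)
    fix p assume p: "p \<le> r"
    have "(\<Sum>q\<in>{0..int r}. D (int p) q)
        = (\<Sum>q\<in>{0..int r}. a (nat \<bar>int p - q\<bar>) + (if q = int r - int p then h p - s p else 0))"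
      using p by (intro sum.cong) (auto simp: D_def)
    also have "\<dots> = s p + (h p - s p)"
      using p by (simp add: sum.distrib s_def)
    finally show "(\<Sum>q\<in>{0..int r}. D (int p) q) = h p"
      using s_le[OF p] by simp
  next
    fix p q :: int
    show "D q p = D p q"
    proof (cases "p + q = int r")
      case True
      then have "q = int r - p" by simp
      then show ?thesis using rest_sym[of p] by (auto simp: D_def abs_minus_commute)
    qed (auto simp: D_def abs_minus_commute add.commute)
    show "D (int r - q) (int r - p) = D p q"
    proof (cases "p + q = int r")
      case True
      then have "int r - q = p" "int r - p = q" by simp_all
      then show ?thesis by metis
    next
      case False
      have "int r - q - (int r - p) = p - q" by simp
      then show ?thesis using False by (auto simp: D_def)
    qed
    show "D p q \<le> D (p + 1) (q + 1)" if "p + q < int r"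
    proof -
      have "p + 1 \<le> int r \<and> q + 1 \<le> int r" if "0 \<le> p" "0 \<le> q"
        using that \<open>p + q < int r\<close> by linarith
      moreover have "p + 1 - (q + 1) = p - q" by simp
      ultimately show ?thesis using that by (auto simp: D_def)
    qed
  qed (auto simp: D_def)
  moreover have "gr0_part D = a"
  proof
    fix k
    \<comment> \<open>At the corner \<open>(0, r)\<close> the correction is
      \<open>h 0 - s 0 = 0\<close>, so row 0 is exactly \<open>a\<close>.\<close>
    show "gr0_part D k = a k"
      using a_zero[of k] s_0 by (auto simp: gr0_part_def D_def)
  qed
  ultimately show ?thesis by blast
qed

section \<open>Sums of Lefschetz strings\<close>

text \<open>The Lefschetz decomposition, isolated from \<open>polarized_rel\<close> so that the
  source of an arrow can be assembled from primitive parts in the same way as its target.\<close>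

definition lefschetz_sum :: "nat \<Rightarrow> (nat \<Rightarrow> diamond) \<Rightarrow> diamond" where
  "lefschetz_sum r X = (\<lambda>p q. \<Sum>w\<in>{0..r}. \<Sum>a\<in>{0..r - w}. twist (X w) a p q)"

lemma polarized_rel_iff:
  "polarized_rel r D1 D0 \<longleftrightarrow>
     (\<exists>X. (\<forall>w\<le>r. admissible w (primitive_hodge D1 w) (X w)) \<and> D0 = lefschetz_sum r X)"
  unfolding polarized_rel_def lefschetz_sum_def fun_eq_iff by simp

definition zero_ext :: "nat \<Rightarrow> (nat \<Rightarrow> nat) \<Rightarrow> int \<Rightarrow> nat" where
  "zero_ext w f x = (if 0 \<le> x \<and> x \<le> int w then f (nat x) else 0)"

text \<open>Both sides are the sum over \<open>a\<close> in \<open>0..n + 1\<close>, with the last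
  or the first term split off. It is stated additively to avoid subtraction in
  \<open>nat\<close>.\<close>

lemma twist_string_shift:
  "(\<Sum>a\<in>{0..n}. twist X a p q) + X (p - 1 - int n) (q - 1 - int n)
     = X p q + (\<Sum>a\<in>{0..n}. twist X a (p - 1) (q - 1))"
proof -
  have "(\<Sum>a\<in>{0..Suc n}. twist X a p q) = twist X 0 p q + (\<Sum>a\<in>{0..n}. twist X (Suc a) p q)"
    by (rule sum.atLeast0_atMost_Suc_shift[unfolded comp_def])
  then show ?thesis
    by (simp add: twist_def algebra_simps)
qed

lemma row_sum_twist:
  assumes X: "admissible w P X" and a: "a + w \<le> r"
  shows "(\<Sum>q\<in>{0..int r}. twist X a p q) = zero_ext w P (p - int a)"
proof -
  let ?x = "p - int a"
  have "(\<Sum>q\<in>{0..int r}. twist X a p q) = (\<Sum>y\<in>{- int a..int r - int a}. X ?x y)"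
    by (rule sum.reindex_bij_witness[where i = "\<lambda>y. y + int a" and j = "\<lambda>q. q - int a"])
      (auto simp: twist_def)
  also have "\<dots> = (\<Sum>y\<in>{0..int w}. X ?x y)"
    by (rule sum.mono_neutral_right) (use a admissible_zero[OF X] in auto)
  also have "\<dots> = zero_ext w P ?x"
    using admissible_row_sum[OF X, of "nat ?x"] admissible_zero[OF X, of ?x]
    by (auto simp: zero_ext_def nat_le_iff)
  finally show ?thesis .
qed

text \<open>The reflection of weight \<open>r\<close> sends the twist \<open>a\<close> of a weight
  \<open>w\<close> diamond to the twist \<open>r - w - a\<close>, so each string is symmetric as a
  whole.\<close>

lemma admissible_lefschetz_sum:
  assumes X: "\<And>w. w \<le> r \<Longrightarrow> admissible w (P w) (X w)"
    and h: "\<And>p. p \<le> r \<Longrightarrow> h p = (\<Sum>w\<in>{0..r}. \<Sum>a\<in>{0..r - w}. zero_ext w (P w) (int p - int a))"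
  shows "admissible r h (lefschetz_sum r X)"
proof (rule admissibleI)
  fix p q :: int
  assume *: "\<not> (0 \<le> p \<and> p \<le> int r \<and> 0 \<le> q \<and> q \<le> int r)"
  have "twist (X w) a p q = 0" if "w \<le> r" "a \<le> r - w" for w a
    unfolding twist_def using * that by (intro admissible_zero[OF X[OF that(1)]]) linarith
  then show "lefschetz_sum r X p q = 0"
    by (auto simp: lefschetz_sum_def intro!: sum.neutral)
next
  fix p assume p: "p \<le> r"
  have "(\<Sum>q\<in>{0..int r}. lefschetz_sum r X (int p) q)
      = (\<Sum>w\<in>{0..r}. \<Sum>a\<in>{0..r - w}. \<Sum>q\<in>{0..int r}. twist (X w) a (int p) q)"
    unfolding lefschetz_sum_def
    by (subst sum.swap, intro sum.cong[OF refl], subst sum.swap, simp)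
  also have "\<dots> = h p"
    unfolding h[OF p] by (intro sum.cong refl row_sum_twist X) auto
  finally show "(\<Sum>q\<in>{0..int r}. lefschetz_sum r X (int p) q) = h p" .
next
  fix p q :: int
  show "lefschetz_sum r X q p = lefschetz_sum r X p q"
    unfolding lefschetz_sum_def twist_def
    by (intro sum.cong refl admissible_transpose[OF X]) auto
  show "lefschetz_sum r X (int r - q) (int r - p) = lefschetz_sum r X p q"
    unfolding lefschetz_sum_def
  proof (rule sum.cong[OF refl])
    fix w assume w: "w \<in> {0..r}"
    have "twist (X w) a (int r - q) (int r - p) = twist (X w) (r - w - a) p q"
      if "a \<le> r - w" for a
    proof -
      have "int r - q - int a = int w - (q - int (r - w - a))"
        "int r - p - int a = int w - (p - int (r - w - a))"
        using that w by (auto simp: of_nat_diff)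
      then show ?thesis
        unfolding twist_def using admissible_reflect[OF X] w by (metis atLeastAtMost_iff)
    qed
    then show "(\<Sum>a\<in>{0..r - w}. twist (X w) a (int r - q) (int r - p))
        = (\<Sum>a\<in>{0..r - w}. twist (X w) a p q)"
      by (intro sum.reindex_bij_witness[where i = "\<lambda>a. r - w - a" and j = "\<lambda>a. r - w - a"]) auto
  qed
  show "lefschetz_sum r X p q \<le> lefschetz_sum r X (p + 1) (q + 1)" if pq: "p + q < int r"
    unfolding lefschetz_sum_def
  proof (rule sum_mono)
    fix w assume w: "w \<in> {0..r}"
    let ?n = "r - w"
    \<comment> \<open>By telescoping, the two string sums differ only in these end terms,
      \<open>r - w + 1\<close> diagonal steps apart. The condition for unimodality in weight
      \<open>w\<close> becomes \<open>p + q + 1 <= r\<close>.\<close>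
    have "X w (p - int ?n) (q - int ?n)
        \<le> X w (p - int ?n + int (?n + 1)) (q - int ?n + int (?n + 1))"
      by (rule admissible_unimodal[OF X]) (use w pq in \<open>auto simp: of_nat_diff\<close>)
    then have "X w (p - int ?n) (q - int ?n) \<le> X w (p + 1) (q + 1)"
      by (simp add: algebra_simps)
    then show "(\<Sum>a\<in>{0..r - w}. twist (X w) a p q)
        \<le> (\<Sum>a\<in>{0..r - w}. twist (X w) a (p + 1) (q + 1))"
      using twist_string_shift[where X = "X w" and n = ?n and p = "p + 1" and q = "q + 1"]
      by simp
  qed
qed

lemma gr0_part_lefschetz_sum:
  assumes X: "\<And>w. w \<le> r \<Longrightarrow> admissible w (P w) (X w)"
  shows "gr0_part (lefschetz_sum r X) q = (\<Sum>w\<in>{0..r}. X w 0 (int q))"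
  unfolding gr0_part_def lefschetz_sum_def
proof (rule sum.cong[OF refl])
  fix w assume w: "w \<in> {0..r}"
  have "(\<Sum>a\<in>{0..r - w}. twist (X w) a 0 (int q)) = (\<Sum>a\<in>{0}. twist (X w) a 0 (int q))"
    unfolding twist_def
    by (rule sum.mono_neutral_right) (use admissible_zero[OF X, of w] w in auto)
  then show "(\<Sum>a\<in>{0..r - w}. twist (X w) a 0 (int q)) = X w 0 (int q)"
    by (simp add: twist_def)
qed

text \<open>This is the diamond of a pure Hodge structure of weight \<open>w\<close> with Hodge
  numbers \<open>f\<close>.\<close>

definition antidiagonal :: "nat \<Rightarrow> (nat \<Rightarrow> nat) \<Rightarrow> diamond" where
  "antidiagonal w f = (\<lambda>p q. if p + q = int w then zero_ext w f p else 0)"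

lemma admissible_antidiagonal:
  assumes f: "\<And>p. p \<le> w \<Longrightarrow> f p = f (w - p)"
  shows "admissible w f (antidiagonal w f)"
proof (rule admissibleI)
  fix p assume p: "p \<le> w"
  have "(\<Sum>q\<in>{0..int w}. antidiagonal w f (int p) q)
      = (\<Sum>q\<in>{0..int w}. if q = int w - int p then f p else 0)"
    using p by (intro sum.cong) (auto simp: antidiagonal_def zero_ext_def)
  then show "(\<Sum>q\<in>{0..int w}. antidiagonal w f (int p) q) = f p"
    using p by simp
next
  fix p q :: int
  show "antidiagonal w f q p = antidiagonal w f p q"
  proof (cases "p + q = int w \<and> 0 \<le> p \<and> 0 \<le> q")
    case True
    then have "nat q = w - nat p" by linarith
    then show ?thesis using True f[of "nat p"] by (auto simp: antidiagonal_def zero_ext_def)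
  qed (auto simp: antidiagonal_def zero_ext_def)
  show "antidiagonal w f (int w - q) (int w - p) = antidiagonal w f p q"
  proof (cases "p + q = int w")
    case True
    then have "int w - q = p" "int w - p = q" by simp_all
    then show ?thesis by metis
  qed (auto simp: antidiagonal_def)
qed (auto simp: antidiagonal_def zero_ext_def)

text \<open>Passing from \<open>(p - 1, q - 1)\<close> to \<open>(p, q)\<close> with
  \<open>p + q = w\<close> adds only the start of the strings, and a pure diamond of weight
  \<open>v\<close> is nonzero there only if \<open>v = w\<close>. Hence primitive parts can be
  prescribed.\<close>

lemma primitive_hodge_lefschetz_antidiagonal:
  assumes "w \<le> r" "p \<le> w"
  shows "primitive_hodge (lefschetz_sum r (\<lambda>v. antidiagonal v (P v))) w p = P w p"
proof -
  let ?D = "lefschetz_sum r (\<lambda>v. antidiagonal v (P v))"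
  define q where "q = int w - int p"
  have pq: "int p + q = int w" by (simp add: q_def)
  have "?D (int p) q = (\<Sum>v\<in>{0..r}. antidiagonal v (P v) (int p) q
      + (\<Sum>a\<in>{0..r - v}. twist (antidiagonal v (P v)) a (int p - 1) (q - 1)))"
    unfolding lefschetz_sum_def
  proof (rule sum.cong[OF refl])
    fix v assume "v \<in> {0..r}"
    \<comment> \<open>The term past the end of the string could be nonzero only if
      \<open>w = 2 * r - v + 2\<close>, which exceeds \<open>r\<close>.\<close>
    then have "antidiagonal v (P v) (int p - 1 - int (r - v)) (q - 1 - int (r - v)) = 0"
      using pq assms by (auto simp: antidiagonal_def of_nat_diff)
    then show "(\<Sum>a\<in>{0..r - v}. twist (antidiagonal v (P v)) a (int p) q)
        = antidiagonal v (P v) (int p) q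
          + (\<Sum>a\<in>{0..r - v}. twist (antidiagonal v (P v)) a (int p - 1) (q - 1))"
      using twist_string_shift[where X = "antidiagonal v (P v)" and n = "r - v" and p = "int p" and q = q]
      by simp
  qed
  also have "\<dots> = (\<Sum>v\<in>{0..r}. antidiagonal v (P v) (int p) q) + ?D (int p - 1) (q - 1)"
    by (simp add: sum.distrib lefschetz_sum_def)
  also have "(\<Sum>v\<in>{0..r}. antidiagonal v (P v) (int p) q) = (\<Sum>v\<in>{0..r}. if v = w then P w p else 0)"
    by (intro sum.cong) (use pq assms in \<open>auto simp: antidiagonal_def zero_ext_def\<close>)
  also have "\<dots> = P w p"
    using assms by simp
  finally show ?thesis
    by (simp add: primitive_hodge_def q_def)
qed

section \<open>Arrows and the dominance order\<close>

lemma primitive_hodge_0: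
  "admissible r h D \<Longrightarrow> primitive_hodge D w 0 = D 0 (int w)"
  by (simp add: primitive_hodge_def admissible_zero)

text \<open>Row 0 of \<open>X w\<close> spreads the mass \<open>D1 0 w\<close> over columns
  \<open>q <= w\<close>, so mass only moves to the left.\<close>

lemma polarized_rel_dom_le:
  assumes D1: "admissible r h D1" and rel: "polarized_rel r D1 D0"
  shows "dom_le r (gr0_part D1) (gr0_part D0)"
  unfolding dom_le_def
proof (intro allI impI)
  fix l assume l: "l \<le> r"
  obtain X where X: "\<And>w. w \<le> r \<Longrightarrow> admissible w (primitive_hodge D1 w) (X w)"
    and D0: "D0 = lefschetz_sum r X"
    using rel unfolding polarized_rel_iff by blast
  have gr0: "gr0_part D0 q = (\<Sum>w\<in>{0..r}. X w 0 (int q))" for q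
    unfolding D0 by (rule gr0_part_lefschetz_sum) (rule X)
  have "(\<Sum>w\<in>{0..l}. gr0_part D1 w) = (\<Sum>w\<in>{0..l}. \<Sum>q\<in>{0..w}. X w 0 (int q))"
    using l by (intro sum.cong refl)
      (simp add: admissible_gr0_sum[OF X] primitive_hodge_0[OF D1] gr0_part_def)
  also have "\<dots> \<le> (\<Sum>w\<in>{0..l}. \<Sum>q\<in>{0..l}. X w 0 (int q))"
    by (intro sum_mono sum_mono2) auto
  also have "\<dots> \<le> (\<Sum>w\<in>{0..r}. \<Sum>q\<in>{0..l}. X w 0 (int q))"
    using l by (intro sum_mono2) auto
  also have "\<dots> = (\<Sum>q\<in>{0..l}. gr0_part D0 q)"
    unfolding gr0 by (rule sum.swap)
  finally show "(\<Sum>w\<in>{0..l}. gr0_part D1 w) \<le> (\<Sum>q\<in>{0..l}. gr0_part D0 q)" .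
qed

lemma sum_card_Int_consecutive:
  fixes A :: "nat \<Rightarrow> nat"
  assumes "mono A" "finite S"
  shows "(\<Sum>q<n. card (S \<inter> {A q..<A (Suc q)})) = card (S \<inter> {A 0..<A n})"
proof (induction n)
  case (Suc n)
  have "A 0 \<le> A n" "A n \<le> A (Suc n)"
    using assms(1) by (auto simp: mono_def)
  then have "S \<inter> {A 0..<A (Suc n)} = S \<inter> {A 0..<A n} \<union> S \<inter> {A n..<A (Suc n)}"
    by auto
  then have "card (S \<inter> {A 0..<A (Suc n)}) = card (S \<inter> {A 0..<A n}) + card (S \<inter> {A n..<A (Suc n)})"
    using assms(2) by (simp add: card_Un_disjoint disjoint_iff)
  then show ?case using Suc by simp
qed simp

text \<open>
  The plan is the north-west corner rule: cut \<open>[0, m)\<close> into consecutive blocks of lengths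
  \<open>a1 w\<close>, respectively \<open>a0 q\<close>, and move the overlap of block \<open>w\<close> with block \<open>q\<close>.
\<close>

lemma dom_le_transport:
  assumes a1: "a1 \<in> funs r m" and a0: "a0 \<in> funs r m" and le: "dom_le r a1 a0"
  obtains t where "\<And>w. w \<le> r \<Longrightarrow> t w \<in> funs w (a1 w)"
    and "\<And>q. (\<Sum>w\<in>{0..r}. t w q) = a0 q"
proof
  define A where "A a n = (\<Sum>k<n. a k)" for a :: "nat \<Rightarrow> nat" and n
  define I where "I a k = {A a k..<A a (Suc k)}" for a k
  define t where "t w q = card (I a1 w \<inter> I a0 q)" for w q
  have mono_A: "mono (A a)" for a
    unfolding mono_def A_def by (auto intro!: sum_mono2)
  have A_0: "A a 0 = 0" for a by (simp add: A_def)
  have card_I: "card (I a k) = a k" for a k by (simp add: I_def A_def)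
  have A_Suc: "A a (Suc l) = (\<Sum>k\<in>{0..l}. a k)" for a l
    by (simp add: A_def lessThan_Suc_atMost atLeast0AtMost)
  have total: "A a (Suc r) = m" if "a \<in> funs r m" for a
    using that by (simp add: A_Suc funs_def)
  have I_sub: "I a k \<subseteq> {0..<m}" if "a \<in> funs r m" "k \<le> r" for a k
    using monoD[OF mono_A, of "Suc k" "Suc r" a] that by (auto simp: I_def total)
  have zero: "t w q = 0" if "w \<le> r" "w < q" for w q
  proof -
    \<comment> \<open>Dominance enters here: block \<open>w\<close> of \<open>a1\<close> ends before
      block \<open>q\<close> of \<open>a0\<close> begins.\<close>
    have "A a1 (Suc w) \<le> A a0 (Suc w)"
      using le \<open>w \<le> r\<close> by (simp add: dom_le_def A_Suc)
    also have "\<dots> \<le> A a0 q"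
      using that(2) by (intro monoD[OF mono_A]) simp
    finally have "I a1 w \<inter> I a0 q = {}"
      by (auto simp: I_def)
    then show ?thesis by (simp add: t_def)
  qed
  show "t w \<in> funs w (a1 w)" if w: "w \<le> r" for w
  proof -
    have "(\<Sum>q\<in>{0..w}. t w q) = (\<Sum>q<Suc r. t w q)"
      using w zero by (intro sum.mono_neutral_left) auto
    also have "\<dots> = card (I a1 w \<inter> {A a0 0..<A a0 (Suc r)})"
      unfolding t_def I_def[of a0] by (rule sum_card_Int_consecutive[OF mono_A]) (simp add: I_def)
    also have "I a1 w \<inter> {A a0 0..<A a0 (Suc r)} = I a1 w"
      using I_sub[OF a1 w] total[OF a0] by (auto simp: A_0)
    finally show ?thesis
      using zero[OF w] by (simp add: funs_def card_I)
  qed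
  show "(\<Sum>w\<in>{0..r}. t w q) = a0 q" for q
  proof (cases "q \<le> r")
    case True
    have "(\<Sum>w\<in>{0..r}. t w q) = (\<Sum>w<Suc r. card (I a0 q \<inter> I a1 w))"
      by (simp add: t_def Int_commute lessThan_Suc_atMost atLeast0AtMost)
    also have "\<dots> = card (I a0 q \<inter> {A a1 0..<A a1 (Suc r)})"
      unfolding I_def[of a1] by (rule sum_card_Int_consecutive[OF mono_A]) (simp add: I_def)
    also have "I a0 q \<inter> {A a1 0..<A a1 (Suc r)} = I a0 q"
      using I_sub[OF a0 True] total[OF a1] by (auto simp: A_0)
    finally show ?thesis by (simp add: card_I)
  next
    case False
    then have "a0 q = 0" using a0 by (simp add: funs_def)
    then show ?thesis using zero False by simp
  qed
qed

section \<open>The two bounds\<close>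

lemma c_fun_sym: "p \<le> w \<Longrightarrow> c_fun w p = c_fun w (w - p)"
  by (auto simp: c_fun_def)

lemma b_fun_sym: "p \<le> r \<Longrightarrow> b_fun r (r - p) = b_fun r p"
  by (auto simp: b_fun_def)

lemma c_fun_le_b_fun: "0 < r \<Longrightarrow> i \<le> r \<Longrightarrow> c_fun r i \<le> b_fun r i"
  by (auto simp: c_fun_def b_fun_def)

lemma sum_c_fun_less: "i < w \<Longrightarrow> (\<Sum>p\<in>{0..i}. c_fun w p) = 2 * i + 1"
  by (induction i) (auto simp: c_fun_def)

lemma sum_c_fun_total: "0 < w \<Longrightarrow> (\<Sum>p\<in>{0..w}. c_fun w p) = 2 * w"
  using sum_c_fun_less[of "w - 1" w] by (cases w) (auto simp: c_fun_def)

text \<open>For \<open>2 * i < r\<close> the sum stops before the final value 1 of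
  \<open>c_fun (r - i)\<close>. For \<open>2 * i = r\<close> it includes that value, which explains
  the exceptional middle value of \<open>b_fun\<close>.\<close>

lemma sum_c_fun_eq_b_fun:
  assumes "0 < r" "2 * i \<le> r"
  shows "(\<Sum>p\<in>{0..i}. c_fun (r - i) p) = b_fun r i"
proof (cases "2 * i = r")
  case True
  then have "r - i = i" by simp
  then show ?thesis using True assms sum_c_fun_total[of i] by (simp add: b_fun_def)
next
  case False
  then show ?thesis using assms sum_c_fun_less[of i "r - i"] by (simp add: b_fun_def)
qed

lemma lefschetz_row_le_b_fun:
  assumes r: "0 < r" and p: "2 * p \<le> r" and w: "w \<le> r"
  shows "(\<Sum>a\<in>{0..r - w}. zero_ext w (c_fun w) (int p - int a)) \<le> b_fun r p"
proof -
  \<comment> \<open>\<open>T\<close> consists of the indices \<open>x = p - a\<close> at which the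
    twists \<open>0 <= a <= r - w\<close> meet the type \<open>c_fun w\<close> in row
    \<open>p\<close>.\<close>
  define T where "T = {x. x \<le> p \<and> x \<le> w \<and> p \<le> x + (r - w)}"
  have fin: "finite T"
    by (rule finite_subset[of _ "{0..p}"]) (auto simp: T_def)
  have "(\<Sum>a\<in>{0..r - w}. zero_ext w (c_fun w) (int p - int a))
      = (\<Sum>a\<in>{a\<in>{0..r - w}. a \<le> p \<and> p - a \<le> w}. zero_ext w (c_fun w) (int p - int a))"
    by (rule sum.mono_neutral_right) (auto simp: zero_ext_def)
  also have "\<dots> = (\<Sum>a\<in>{a\<in>{0..r - w}. a \<le> p \<and> p - a \<le> w}. c_fun w (p - a))"
    by (rule sum.cong[OF refl]) (auto simp: zero_ext_def simp flip: of_nat_diff)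
  also have "\<dots> = sum (c_fun w) T"
    by (rule sum.reindex_bij_witness[where i = "\<lambda>x. p - x" and j = "\<lambda>a. p - a"])
      (auto simp: T_def)
  also have "\<dots> \<le> b_fun r p"
  proof (cases "w \<le> p")
    case True
    have "sum (c_fun w) T \<le> (\<Sum>x\<in>{0..w}. c_fun w x)"
      by (rule sum_mono2) (auto simp: T_def)
    also have "\<dots> \<le> b_fun r p"
      using True r p sum_c_fun_total[of w] by (cases "w = 0") (auto simp: b_fun_def c_fun_def)
    finally show ?thesis .
  next
    case less: False
    show ?thesis
    proof (cases "2 * p = r")
      case True
      \<comment> \<open>In the middle row the partial sum \<open>2 * p + 1\<close> would be too
        large by one. Instead, at most \<open>r - w + 1 <= p\<close> terms of size at most 2 are
        counted.\<close>
      have "sum (c_fun w) T \<le> (\<Sum>x\<in>T. 2)"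
        by (rule sum_mono) (auto simp: c_fun_def)
      moreover have "T \<subseteq> {p - (r - w)..p}"
        by (auto simp: T_def)
      then have "card T \<le> card {p - (r - w)..p}"
        by (intro card_mono) auto
      ultimately show ?thesis
        using True less w by (simp add: b_fun_def)
    next
      case False
      have "sum (c_fun w) T \<le> (\<Sum>x\<in>{0..p}. c_fun w x)"
        by (rule sum_mono2) (auto simp: T_def)
      then show ?thesis
        using False p less sum_c_fun_less[of p w] by (simp add: b_fun_def)
    qed
  qed
  finally show ?thesis .
qed

text \<open>Both ends of the arrow are Lefschetz sums over the same primitive types
  \<open>P w\<close>, hence both have type \<open>h\<close>: pure diamonds give \<open>D1\<close>,
  diamonds with first rows \<open>t w\<close> give \<open>D0\<close>.\<close>

lemma dom_le_imp_arrow: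
  assumes h_sym: "\<And>p. p \<le> r \<Longrightarrow> h p = h (r - p)"
    and h_ge: "\<And>i. i \<le> r \<Longrightarrow> h 0 * b_fun r i \<le> h i"
    and a1: "a1 \<in> funs r (h 0)" and a0: "a0 \<in> funs r (h 0)" and le: "dom_le r a1 a0"
  shows "(a1, a0) \<in> R0_arrows r h"
proof -
  obtain t where t: "\<And>w. w \<le> r \<Longrightarrow> t w \<in> funs w (a1 w)"
    and t_sum: "\<And>q. (\<Sum>w\<in>{0..r}. t w q) = a0 q"
    using dom_le_transport[OF a1 a0 le] by blast
  have a1_sum: "(\<Sum>w\<in>{0..r}. a1 w) = h 0" and a1_zero: "\<And>k. k > r \<Longrightarrow> a1 k = 0"
    using a1 by (auto simp: funs_def)
  define Q where "Q w p = a1 w * c_fun w p" for w p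
  define s where "s p = (\<Sum>w\<in>{0..r}. \<Sum>a\<in>{0..r - w}. zero_ext w (Q w) (int p - int a))" for p
  have Q_sym: "Q w p = Q w (w - p)" if "p \<le> w" for w p
    using c_fun_sym[OF that] by (simp add: Q_def)
  \<comment> \<open>This auxiliary diamond serves to make \<open>s\<close> symmetric, so that
    \<open>s <= h\<close> has to be checked only up to the middle row.\<close>
  have s_adm: "admissible r s (lefschetz_sum r (\<lambda>w. antidiagonal w (Q w)))"
    by (rule admissible_lefschetz_sum[where P = Q])
      (auto intro!: admissible_antidiagonal Q_sym simp: s_def)
  have s_alt: "s p = (\<Sum>w\<in>{0..r}. a1 w * (\<Sum>a\<in>{0..r - w}. zero_ext w (c_fun w) (int p - int a)))" for p
    unfolding s_def sum_distrib_left by (intro sum.cong refl) (simp add: zero_ext_def Q_def)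
  have s_0: "s 0 = h 0"
  proof -
    have "(\<Sum>a\<in>{0..r - w}. zero_ext w (c_fun w) (int 0 - int a)) = 1" for w
    proof -
      have "(\<Sum>a\<in>{0..r - w}. zero_ext w (c_fun w) (int 0 - int a))
          = (\<Sum>a\<in>{0}. zero_ext w (c_fun w) (int 0 - int a))"
        by (rule sum.mono_neutral_right) (auto simp: zero_ext_def)
      then show ?thesis by (simp add: zero_ext_def c_fun_def)
    qed
    then show ?thesis by (simp only: s_alt a1_sum mult_1_right)
  qed
  have s_le_half: "s p \<le> h p" if p: "2 * p \<le> r" for p
  proof (cases "r = 0")
    case True
    then show ?thesis using p s_0 by simp
  next
    case False
    have "s p \<le> (\<Sum>w\<in>{0..r}. a1 w * b_fun r p)"
      unfolding s_alt using False p
      by (intro sum_mono mult_left_mono lefschetz_row_le_b_fun) auto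
    also have "\<dots> = h 0 * b_fun r p"
      by (simp add: a1_sum flip: sum_distrib_right)
    also have "\<dots> \<le> h p"
      using h_ge p by simp
    finally show ?thesis .
  qed
  have s_sym: "s (r - p) = s p" if "p \<le> r" for p
    by (rule admissible_hodge_sym[OF s_adm that])
  have s_le: "s p \<le> h p" if "p \<le> r" for p
    using s_le_half[of p] s_le_half[of "r - p"] s_sym[OF that] h_sym[OF that] that
    by (cases "2 * p \<le> r") auto
  \<comment> \<open>The surplus \<open>h - s\<close> goes into the primitive part of weight
    \<open>r\<close>, whose string has length one, so each row receives it exactly once. Since
    \<open>s 0 = h 0\<close>, row 0 is unaffected.\<close>
  define P where "P w p = Q w p + (if w = r then h p - s p else 0)" for w p
  have P_sym: "P w p = P w (w - p)" if "p \<le> w" for w p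
    using Q_sym[OF that] h_sym[of p] s_sym[of p] that by (auto simp: P_def)
  have P_0: "P w 0 = a1 w" for w
    using s_0 by (simp add: P_def Q_def c_fun_def)
  have h_eq: "h p = (\<Sum>w\<in>{0..r}. \<Sum>a\<in>{0..r - w}. zero_ext w (P w) (int p - int a))" if p: "p \<le> r" for p
  proof -
    have "(\<Sum>w\<in>{0..r}. \<Sum>a\<in>{0..r - w}. zero_ext w (P w) (int p - int a))
        = (\<Sum>w\<in>{0..r}. (\<Sum>a\<in>{0..r - w}. zero_ext w (Q w) (int p - int a)) + (if w = r then h p - s p else 0))"
    proof (rule sum.cong[OF refl])
      fix w
      show "(\<Sum>a\<in>{0..r - w}. zero_ext w (P w) (int p - int a))
          = (\<Sum>a\<in>{0..r - w}. zero_ext w (Q w) (int p - int a)) + (if w = r then h p - s p else 0)"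
      proof (cases "w = r")
        case True
        then show ?thesis using p by (simp add: P_def zero_ext_def)
      next
        case False
        then have "P w = Q w" by (simp add: P_def fun_eq_iff)
        then show ?thesis using False by simp
      qed
    qed
    also have "\<dots> = s p + (h p - s p)"
      by (simp add: sum.distrib s_def)
    finally show ?thesis using s_le[OF p] by simp
  qed
  define D1 where "D1 = lefschetz_sum r (\<lambda>w. antidiagonal w (P w))"
  have anti: "admissible w (P w) (antidiagonal w (P w))" for w
    using P_sym by (rule admissible_antidiagonal)
  have D1: "admissible r h D1"
    unfolding D1_def using anti h_eq by (rule admissible_lefschetz_sum)
  have gr_D1: "gr0_part D1 = a1"
  proof
    fix q
    have "gr0_part D1 q = (\<Sum>w\<in>{0..r}. antidiagonal w (P w) 0 (int q))"
      unfolding D1_def by (rule gr0_part_lefschetz_sum) (rule anti)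
    also have "\<dots> = (\<Sum>w\<in>{0..r}. if w = q then a1 q else 0)"
      by (intro sum.cong) (auto simp: antidiagonal_def zero_ext_def P_0)
    finally show "gr0_part D1 q = a1 q"
      using a1_zero[of q] by auto
  qed
  have "\<exists>X. admissible w (P w) X \<and> gr0_part X = t w" if "w \<le> r" for w
  proof (rule admissible_prescribed_gr0)
    show "t w \<in> funs w (P w 0)"
      using t[OF that] by (simp add: P_0)
    show "P w 0 * c_fun w i \<le> P w i" for i
      unfolding P_0 by (simp add: P_def Q_def)
  qed (rule P_sym)
  then obtain X where X: "\<And>w. w \<le> r \<Longrightarrow> admissible w (P w) (X w)"
    and gr_X: "\<And>w. w \<le> r \<Longrightarrow> gr0_part (X w) = t w"
    by metis
  define D0 where "D0 = lefschetz_sum r X"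
  have D0: "admissible r h D0"
    unfolding D0_def using X h_eq by (rule admissible_lefschetz_sum)
  have gr_D0: "gr0_part D0 = a0"
  proof
    fix q
    have "gr0_part D0 q = (\<Sum>w\<in>{0..r}. X w 0 (int q))"
      unfolding D0_def by (rule gr0_part_lefschetz_sum) (rule X)
    also have "\<dots> = (\<Sum>w\<in>{0..r}. t w q)"
      using gr_X by (intro sum.cong refl) (auto simp: gr0_part_def fun_eq_iff)
    finally show "gr0_part D0 q = a0 q" by (simp add: t_sum)
  qed
  have X': "admissible w (primitive_hodge D1 w) (X w)" if "w \<le> r" for w
  proof (rule admissible_cong[THEN iffD2])
    show "primitive_hodge D1 w p = P w p" if "p \<le> w" for p
      unfolding D1_def using \<open>w \<le> r\<close> that by (rule primitive_hodge_lefschetz_antidiagonal)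
  qed (rule X[OF that])
  have "polarized_rel r D1 D0"
    unfolding polarized_rel_iff by (intro exI[of _ X] conjI allI impI X' D0_def)
  then show ?thesis
    unfolding R0_arrows_def mem_Collect_eq using D1 D0 gr_D1 gr_D0 by (intro exI[of _ D1] exI[of _ D0]) simp
qed

lemma R0_maximal_iff:
  assumes h_sym: "\<And>p. p \<le> r \<Longrightarrow> h p = h (r - p)"
  shows "R0_maximal r h \<longleftrightarrow> (\<forall>i\<le>r. h 0 * c_fun r i \<le> h i)"
proof
  assume max: "R0_maximal r h"
  show "\<forall>i\<le>r. h 0 * c_fun r i \<le> h i"
  proof (intro allI impI)
    fix i assume i: "i \<le> r"
    show "h 0 * c_fun r i \<le> h i"
    proof (cases "i = 0 \<or> i = r")
      case True
      then have "h i = h 0" using h_sym[of 0] by auto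
      then show ?thesis using True by (auto simp: c_fun_def)
    next
      case False
      \<comment> \<open>The extremal vertex: all mass in column 1, where
        \<open>admissible_interior_lower_bound\<close> sees it.\<close>
      define a where "a k = (if k = 1 then h 0 else 0)" for k :: nat
      have "a \<in> funs r (h 0)"
        using False i by (auto simp: funs_def a_def)
      then have "a \<in> R0_vertices r h"
        using max by (simp add: R0_maximal_def)
      then obtain D where D: "admissible r h D" "gr0_part D = a"
        by (auto simp: R0_vertices_def)
      have "D 0 1 = a 1"
        using D(2) by (auto simp: gr0_part_def)
      then show ?thesis
        using admissible_interior_lower_bound[OF D(1), of i] False i
        by (simp add: a_def c_fun_def)
    qed
  qed
next
  assume h_ge: "\<forall>i\<le>r. h 0 * c_fun r i \<le> h i"
  have "funs r (h 0) \<subseteq> R0_vertices r h"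
  proof
    fix a assume "a \<in> funs r (h 0)"
    with h_sym have "\<exists>D. admissible r h D \<and> gr0_part D = a"
      using h_ge[rule_format] by (rule admissible_prescribed_gr0)
    then show "a \<in> R0_vertices r h"
      by (auto simp: R0_vertices_def)
  qed
  moreover have "R0_vertices r h \<subseteq> funs r (h 0)"
    unfolding R0_vertices_def by (auto intro: gr0_part_in_funs)
  ultimately show "R0_maximal r h"
    unfolding R0_maximal_def by blast
qed

text \<open>All mass of row 0 comes from weight \<open>w = r - i\<close> and ends in column 1, which
  forces the primitive part of weight \<open>w\<close> to be at least \<open>h 0 * c_fun w\<close>.
  Its entries with \<open>p <= i\<close> then propagate to distinct columns of row \<open>i\<close>
  of \<open>D1\<close>.\<close>

lemma arrow_lower_bound:
  assumes arrow: "((\<lambda>k. if k = r - i then h 0 else 0), (\<lambda>k. if k = 1 then h 0 else 0)) \<in> R0_arrows r h"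
    and i: "0 < i" "2 * i \<le> r"
  shows "h 0 * b_fun r i \<le> h i"
proof -
  define w where "w = r - i"
  have w: "w \<le> r" "i \<le> w" "0 < w" "int w = int r - int i"
    using i by (auto simp: w_def)
  obtain D1 D0 where D1: "admissible r h D1" and rel: "polarized_rel r D1 D0"
    and gr1: "gr0_part D1 = (\<lambda>k. if k = w then h 0 else 0)"
    and gr0: "gr0_part D0 = (\<lambda>k. if k = 1 then h 0 else 0)"
    using arrow unfolding R0_arrows_def w_def by auto
  obtain X where X: "\<And>v. v \<le> r \<Longrightarrow> admissible v (primitive_hodge D1 v) (X v)"
    and D0: "D0 = lefschetz_sum r X"
    using rel unfolding polarized_rel_iff by blast
  have prim_0: "primitive_hodge D1 v 0 = (if v = w then h 0 else 0)" for v
    using fun_cong[OF gr1, of v] by (simp add: primitive_hodge_0[OF D1] gr0_part_def)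
  \<comment> \<open>Row 0 of \<open>X v\<close> has total \<open>D1 0 v = 0\<close>; for
    \<open>v = 0\<close> the position \<open>(0, 1)\<close> lies outside the square.\<close>
  have "X v 0 1 = 0" if "v \<le> r" "v \<noteq> w" for v
  proof (cases "v = 0")
    case True
    then show ?thesis using admissible_zero[OF X[OF that(1)]] by simp
  next
    case False
    have "(\<Sum>k\<in>{0..v}. X v 0 (int k)) = 0"
      using admissible_gr0_sum[OF X[OF that(1)]] that prim_0 by simp
    then have "X v 0 (int 1) = 0"
      using False by (subst (asm) sum_eq_0_iff) (auto dest!: bspec[of _ _ 1])
    then show ?thesis by simp
  qed
  then have "(\<Sum>v\<in>{0..r}. X v 0 1) = (\<Sum>v\<in>{0..r}. if v = w then X w 0 1 else 0)"
    by (intro sum.cong) auto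
  then have X_w: "X w 0 1 = h 0"
    using fun_cong[OF gr0, of 1] w gr0_part_lefschetz_sum[OF X, where q = 1] D0 by simp
  have prim_ge: "h 0 * c_fun w p \<le> primitive_hodge D1 w p" if "p \<le> w" for p
  proof (cases "p = 0 \<or> p = w")
    case True
    then show ?thesis
      using prim_0[of w] admissible_hodge_sym[OF X[OF w(1)], of 0] by (auto simp: c_fun_def)
  next
    case False
    then show ?thesis
      using admissible_interior_lower_bound[OF X[OF w(1)], of p] that
      by (simp add: c_fun_def X_w)
  qed
  \<comment> \<open>Moving \<open>(p, w - p)\<close> by \<open>i - p\<close> steps leads to
    \<open>(i, r - 2 * p)\<close>, a different column for each \<open>p\<close>.\<close>
  have D1_ge: "h 0 * c_fun w p \<le> D1 (int i) (int r - 2 * int p)" if "p \<le> i" for p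
  proof -
    have "h 0 * c_fun w p \<le> D1 (int p) (int w - int p)"
      using prim_ge[of p] that w by (simp add: primitive_hodge_def)
    also have "\<dots> \<le> D1 (int p + int (i - p)) (int w - int p + int (i - p))"
      by (rule admissible_unimodal[OF D1]) (use w that in auto)
    also have "\<dots> = D1 (int i) (int r - 2 * int p)"
      by (rule arg_cong2[where f = D1]) (use w that in auto)
    finally show ?thesis .
  qed
  have "h 0 * b_fun r i = (\<Sum>p\<in>{0..i}. h 0 * c_fun w p)"
    using sum_c_fun_eq_b_fun[of r i] i by (simp add: w_def flip: sum_distrib_left)
  also have "\<dots> \<le> (\<Sum>p\<in>{0..i}. D1 (int i) (int r - 2 * int p))"
    using D1_ge by (intro sum_mono) simp
  also have "\<dots> = (\<Sum>q\<in>(\<lambda>p. int r - 2 * int p) ` {0..i}. D1 (int i) q)"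
    by (simp add: sum.reindex inj_on_def)
  also have "\<dots> \<le> (\<Sum>q\<in>{0..int r}. D1 (int i) q)"
    by (rule sum_mono2) (use i in auto)
  also have "\<dots> = h i"
    using admissible_row_sum[OF D1] i by simp
  finally show ?thesis .
qed

lemma R0_saturated_iff:
  assumes h_sym: "\<And>p. p \<le> r \<Longrightarrow> h p = h (r - p)"
  shows "R0_saturated r h \<longleftrightarrow> (\<forall>i\<le>r. h 0 * b_fun r i \<le> h i)"
proof
  assume sat: "R0_saturated r h"
  have half: "h 0 * b_fun r i \<le> h i" if i: "2 * i \<le> r" for i
  proof (cases "i = 0")
    case True
    then show ?thesis by (simp add: b_fun_def)
  next
    case False
    \<comment> \<open>\<open>a l\<close> puts all mass in column \<open>l\<close>. As
      \<open>1 <= r - i\<close>, the pair \<open>(a (r - i), a 1)\<close> is in dominance order and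
      must be an arrow.\<close>
    define a where "a l = (\<lambda>k::nat. if k = l then h 0 else 0)" for l :: nat
    have "a (r - i) \<in> funs r (h 0)" "a 1 \<in> funs r (h 0)"
      using False i by (auto simp: funs_def a_def)
    moreover have "dom_le r (a (r - i)) (a 1)"
      using False i by (auto simp: dom_le_def a_def)
    ultimately have "(a (r - i), a 1) \<in> R0_arrows r h"
      using sat unfolding R0_saturated_def by simp
    then show ?thesis
      using False i by (intro arrow_lower_bound) (auto simp: a_def)
  qed
  show "\<forall>i\<le>r. h 0 * b_fun r i \<le> h i"
  proof (intro allI impI)
    fix i assume i: "i \<le> r"
    show "h 0 * b_fun r i \<le> h i"
      using half[of i] half[of "r - i"] b_fun_sym[OF i] h_sym[OF i] i
      by (cases "2 * i \<le> r") auto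
  qed
next
  assume h_ge: "\<forall>i\<le>r. h 0 * b_fun r i \<le> h i"
  \<comment> \<open>Maximality follows from \<open>c_fun <= b_fun\<close>, which fails for
    \<open>r = 0\<close>; there the bound reads \<open>h 0 <= h 0\<close>.\<close>
  have "h 0 * c_fun r i \<le> h i" if "i \<le> r" for i
  proof (cases "r = 0")
    case True
    then show ?thesis using that by (simp add: c_fun_def)
  next
    case False
    then show ?thesis
      using h_ge that mult_le_mono2[OF c_fun_le_b_fun[of r i], of "h 0"] le_trans by blast
  qed
  then have "R0_maximal r h"
    using R0_maximal_iff[of r h, OF h_sym] by blast
  moreover have "R0_arrows r h
      = {(a1, a0). a1 \<in> funs r (h 0) \<and> a0 \<in> funs r (h 0) \<and> dom_le r a1 a0}" (is "_ = ?R")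
  proof
    show "R0_arrows r h \<subseteq> ?R"
      unfolding R0_arrows_def by (auto intro: gr0_part_in_funs polarized_rel_dom_le)
    have "(a1, a0) \<in> R0_arrows r h"
      if "a1 \<in> funs r (h 0)" "a0 \<in> funs r (h 0)" "dom_le r a1 a0" for a1 a0
      using h_sym h_ge[rule_format] that by (rule dom_le_imp_arrow)
    then show "?R \<subseteq> R0_arrows r h"
      by auto
  qed
  ultimately show "R0_saturated r h"
    unfolding R0_saturated_def by blast
qed

theorem proposition20:
  fixes r :: nat and h :: "nat \<Rightarrow> nat"
  assumes "\<And>p. p \<le> r \<Longrightarrow> h p = h (r - p)"
    and "h 0 > 0"
  shows "(R0_maximal r h \<longleftrightarrow> (\<forall>i\<le>r. h i \<ge> h 0 * c_fun r i)) \<and>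
         (R0_saturated r h \<longleftrightarrow> (\<forall>i\<le>r. h i \<ge> h 0 * b_fun r i))"
  using R0_maximal_iff[of r h, OF assms(1)] R0_saturated_iff[of r h, OF assms(1)] by blast

end
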